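(* Let $n\ge 1$ and $k$ be integers with $\lfloor n/2\rfloor \le k\le \lfloor (2n-2)/3\rfloor$. Then $$|E(\Phi^n_k)|=\begin{cases}0, & k\in\left\{\frac{n-1}{2},\frac{2n-2}{3}\right\},\\[2pt] (2k-n+1)\binom{n-k-2}{2n-3k-3}, & \text{otherwise.}\end{cases}$$
   Context: A subword of a word is a block of consecutive letters. A binary word (over $\{0,1\}$) of length $n\ge 1$ is Padovan if it starts and ends with $0$, contains no subword $00$, and contains no subword $111$. For $n\ge1$ and $\lfloor n/2\rfloor\le k\le\lfloor(2n-2)/3\rfloor$, the weighted Padovan graph $\Phi^n_k$ is the simple graph whose vertices are all Padovan words of length $n$ with exactly $k$ letters $1$; two vertices are adjacent if one can be obtained from the other by replacing exactly one subword $01$ with $10$. In the claim, $\frac{n-1}{2}$ and $\frac{2n-2}{3}$ are rational numbers (no rounding). *)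

theory Defs
  imports Complex_Main "HOL-Library.Sublist"
begin

definition padovan_word :: "nat list \<Rightarrow> bool" where
  "padovan_word w \<longleftrightarrow>
     w \<noteq> [] \<and> set w \<subseteq> {0, 1} \<and> hd w = 0 \<and> last w = 0 \<and>
     \<not> sublist [0, 0] w \<and> \<not> sublist [1, 1, 1] w"

definition Phi_vertices :: "nat \<Rightarrow> nat \<Rightarrow> nat list set" where
  "Phi_vertices n k = {w. padovan_word w \<and> length w = n \<and> count_list w 1 = k}"

definition replaces_01_by_10 :: "nat list \<Rightarrow> nat list \<Rightarrow> bool" where
  "replaces_01_by_10 u v \<longleftrightarrow> (\<exists>x y. u = x @ [0, 1] @ y \<and> v = x @ [1, 0] @ y)"

definition Phi_adjacent :: "nat list \<Rightarrow> nat list \<Rightarrow> bool" where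
  "Phi_adjacent u v \<longleftrightarrow> replaces_01_by_10 u v \<or> replaces_01_by_10 v u"

text \<open>An edge is the unordered pair of its end points.\<close>

definition Phi_edges :: "nat \<Rightarrow> nat \<Rightarrow> nat list set set" where
  "Phi_edges n k =
     {{u, v} | u v. u \<in> Phi_vertices n k \<and> v \<in> Phi_vertices n k \<and> Phi_adjacent u v}"

lemma Phi_adjacent_irrefl: "\<not> Phi_adjacent u u"
  by (auto simp: Phi_adjacent_def replaces_01_by_10_def)

lemma card_Phi_edge: "e \<in> Phi_edges n k \<Longrightarrow> e \<subseteq> Phi_vertices n k \<and> card e = 2"
  using Phi_adjacent_irrefl by (auto simp: Phi_edges_def card_insert_if)

lemma finite_Phi_vertices: "finite (Phi_vertices n k)"
proof (rule finite_subset)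
  show "Phi_vertices n k \<subseteq> {w. set w \<subseteq> {0, 1} \<and> length w = n}"
    by (auto simp: Phi_vertices_def padovan_word_def)
  show "finite {w. set w \<subseteq> {0, 1::nat} \<and> length w = n}"
    by (rule finite_lists_length_eq) simp
qed

lemma finite_Phi_edges: "finite (Phi_edges n k)"
  by (rule finite_subset[of _ "Pow (Phi_vertices n k)"])
     (use card_Phi_edge finite_Phi_vertices in auto)

end

theory Submission
  imports Defs
begin

text \<open>
  A Padovan word is uniquely a letter \<open>0\<close> followed by blocks \<open>10\<close> and \<open>110\<close>. With \<open>m\<close> blocks,
  \<open>q\<close> of which are \<open>110\<close>, the length is \<open>2m + q + 1\<close> and there are \<open>m + q\<close> letters \<open>1\<close>. Replacing
  \<open>01\<close> by \<open>10\<close> keeps the word Padovan only if it exchanges two consecutive distinct blocks. So an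
  edge is a place among the other \<open>m - 2\<close> blocks, \<open>q - 1\<close> of them \<open>110\<close>, at which to insert the
  two exchanged blocks: there are \<open>(m - 1) * (m - 2 choose q - 1) = q * (m - 1 choose q)\<close> edges.
\<close>

text \<open>\<open>True\<close> stands for the block \<open>110\<close> and \<open>False\<close> for \<open>10\<close>. The recursion groups the letters as
  \<open>011\<close> and \<open>01\<close>, with the last \<open>0\<close> left over.\<close>

fun word_of_blocks :: "bool list \<Rightarrow> nat list" where
  "word_of_blocks [] = [0]"
| "word_of_blocks (True # b) = 0 # 1 # 1 # word_of_blocks b"
| "word_of_blocks (False # b) = 0 # 1 # word_of_blocks b"

section \<open>Block words: first letters and injectivity\<close>

lemma word_of_blocks_neq_Nil [simp]: "word_of_blocks b \<noteq> []"
  by (cases b rule: word_of_blocks.cases) auto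

lemma hd_word_of_blocks [simp]: "hd (word_of_blocks b) = 0"
  by (cases b rule: word_of_blocks.cases) auto

lemma word_of_blocks_neq_Cons_1 [simp]: "word_of_blocks b \<noteq> Suc 0 # z"
  by (cases b rule: word_of_blocks.cases) auto

lemmas Cons_1_neq_word_of_blocks [simp] = word_of_blocks_neq_Cons_1[symmetric]

lemma word_of_blocks_neq_Cons_00 [simp]: "word_of_blocks b \<noteq> 0 # 0 # z"
  by (cases b rule: word_of_blocks.cases) auto

lemma word_of_blocks_neq_0_word_of_blocks [simp]: "word_of_blocks b \<noteq> 0 # word_of_blocks c"
  by (cases c rule: word_of_blocks.cases) auto

text \<open>Every block starts with \<open>01\<close>, so it takes the third letter to tell the
  leading block.\<close>

lemma word_of_blocks_eq_011_iff:
  "word_of_blocks b = 0 # Suc 0 # Suc 0 # z \<longleftrightarrow> (\<exists>c. b = True # c \<and> word_of_blocks c = z)"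
  by (cases b rule: word_of_blocks.cases) auto

lemma word_of_blocks_eq_010_iff:
  "word_of_blocks b = 0 # Suc 0 # 0 # z \<longleftrightarrow> (\<exists>c. b = False # c \<and> word_of_blocks c = 0 # z)"
  by (cases b rule: word_of_blocks.cases) auto

lemma word_of_blocks_eq_iff [simp]: "word_of_blocks a = word_of_blocks b \<longleftrightarrow> a = b"
proof
  show "word_of_blocks a = word_of_blocks b \<Longrightarrow> a = b"
  proof (induction a arbitrary: b rule: word_of_blocks.induct)
    case 1
    then show ?case by (cases b rule: word_of_blocks.cases) auto
  next
    case (2 a)
    then show ?case by (cases b rule: word_of_blocks.cases) auto
  next
    case (3 a)
    then show ?case by (cases b rule: word_of_blocks.cases) auto
  qed
qed simp

section \<open>Padovan words as block words\<close>

lemma length_word_of_blocks: "length (word_of_blocks b) = 2 * length b + count_list b True + 1"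
  by (induction b rule: word_of_blocks.induct) auto

lemma count_list_word_of_blocks: "count_list (word_of_blocks b) 1 = length b + count_list b True"
  by (induction b rule: word_of_blocks.induct) auto

lemma padovan_word_of_blocks: "padovan_word (word_of_blocks b)"
proof -
  \<comment> \<open>A run of ones cannot extend past its own block, since whatever follows starts
    with \<open>0\<close>.\<close>
  have prefix_1: "\<not> prefix (1 # z) (word_of_blocks c)" for z c
    by (cases c rule: word_of_blocks.cases) auto
  have "\<not> sublist [0, 0] (word_of_blocks b) \<and> \<not> sublist [1, 1, 1] (word_of_blocks b)"
    using prefix_1
    by (induction b rule: word_of_blocks.induct) (auto simp: sublist_Cons_right)
  moreover have "set (word_of_blocks b) \<subseteq> {0, 1} \<and> last (word_of_blocks b) = 0"
    by (induction b rule: word_of_blocks.induct) auto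
  ultimately show ?thesis
    by (simp add: padovan_word_def)
qed

text \<open>After its first \<open>0\<close> the word either ends or continues with \<open>1\<close>
  and, as it ends in \<open>0\<close>, at least one more letter. That letter tells \<open>01\<close>
  from \<open>011\<close>; in the second case the absence of \<open>111\<close> makes the rest start
  with \<open>0\<close> again.\<close>

lemma padovan_word_imp_blocks: "padovan_word w \<Longrightarrow> \<exists>b. w = word_of_blocks b"
proof (induction w rule: length_induct)
  case (1 w)
  then obtain u where w: "w = 0 # u"
    by (cases w) (auto simp: padovan_word_def)
  show ?case
  proof (cases u)
    case Nil
    then have "w = word_of_blocks []" using w by simp
    then show ?thesis ..
  next
    case (Cons a v)
    with w "1.prems" have "a = 1"
      by (auto simp: padovan_word_def sublist_Cons_right)
    with w Cons have w1: "w = 0 # 1 # v" by simp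
    with "1.prems" obtain c z where v: "v = c # z" and c: "c = 0 \<or> c = 1"
      by (cases v) (auto simp: padovan_word_def)
    from c show ?thesis
    proof
      assume "c = 0"
      with "1.prems" w1 v have "padovan_word v"
        by (auto simp: padovan_word_def sublist_Cons_right)
      with "1.IH" w1 obtain b where "v = word_of_blocks b" by fastforce
      with w1 have "w = word_of_blocks (False # b)" by simp
      then show ?thesis ..
    next
      assume "c = 1"
      with "1.prems" w1 v have "padovan_word z"
        by (cases z) (auto simp: padovan_word_def sublist_Cons_right)
      with "1.IH" w1 v obtain b where "z = word_of_blocks b" by fastforce
      with w1 v \<open>c = 1\<close> have "w = word_of_blocks (True # b)" by simp
      then show ?thesis ..
    qed
  qed
qed

lemma Phi_vertices_eq_blocks:
  "Phi_vertices (2 * m + q + 1) (m + q) =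
     word_of_blocks ` {b. length b = m \<and> count_list b True = q}"
proof -
  have "padovan_word w \<longleftrightarrow> w \<in> range word_of_blocks" for w
    using padovan_word_of_blocks padovan_word_imp_blocks by blast
  then show ?thesis
    unfolding Phi_vertices_def
    by (auto simp del: One_nat_def simp: length_word_of_blocks count_list_word_of_blocks)
qed

section \<open>Edges as exchanges of consecutive blocks\<close>

text \<open>Common leading blocks are stripped until the exchanged \<open>0\<close> opens the second
  block. The block before it must be \<open>False\<close>, or the exchange would create
  \<open>111\<close>; the block it opens must be \<open>True\<close>, or the exchange would create
  \<open>00\<close>.\<close>

lemma replaces_01_by_10_blocksD:
  assumes "word_of_blocks a = x @ [0, 1] @ y" "word_of_blocks b = x @ [1, 0] @ y"
  shows "\<exists>s t. a = s @ [False, True] @ t \<and> b = s @ [True, False] @ t"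
  using assms
proof (induction a arbitrary: b x rule: word_of_blocks.induct)
  case 1
  then show ?case by (auto simp: Cons_eq_append_conv)
next
  case (2 a)
  from 2(2,3) obtain x' where x': "word_of_blocks a = x' @ [0, 1] @ y"
      "x = 0 # 1 # 1 # x'"
    by (auto simp: Cons_eq_append_conv)
  with 2(3) obtain c where "b = True # c" "word_of_blocks c = x' @ [1, 0] @ y"
    by (auto simp: word_of_blocks_eq_011_iff)
  with 2(1)[OF x'(1)] show ?case
    by (metis append_Cons)
next
  case (3 a)
  from 3(2,3) obtain x' where x': "word_of_blocks a = x' @ [0, 1] @ y" "x = 0 # 1 # x'"
    by (auto simp: Cons_eq_append_conv)
  show ?case
  proof (cases x')
    \<comment> \<open>Here \<open>x = [0, 1]\<close>, so the word of \<open>b\<close> starts with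
      \<open>0110\<close>. If \<open>a\<close> started with \<open>False\<close>, the word of
      \<open>c\<close> would start with \<open>00\<close>.\<close>
    case Nil
    with x' 3(3) obtain c where c: "b = True # c" "word_of_blocks c = 0 # y"
      by (auto simp: word_of_blocks_eq_011_iff)
    with Nil x' obtain d where d: "a = True # d" "y = 1 # word_of_blocks d"
      by (cases a rule: word_of_blocks.cases) auto
    with c have "word_of_blocks c = word_of_blocks (False # d)" by simp
    then have "c = False # d" by (simp only: word_of_blocks_eq_iff)
    with c d have "False # a = [] @ [False, True] @ d" "b = [] @ [True, False] @ d" by auto
    then show ?thesis by blast
  next
    case (Cons e x'')
    \<comment> \<open>The word of \<open>a\<close> starts with the nonempty \<open>x'\<close>, so
      both original words share a leading block \<open>False\<close>.\<close>
    with x' have "e = 0" by (metis hd_word_of_blocks append_Cons list.sel(1))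
    with Cons x' 3(3) obtain c where "b = False # c" "word_of_blocks c = x' @ [1, 0] @ y"
      by (auto simp: word_of_blocks_eq_010_iff)
    with 3(1)[OF x'(1)] show ?thesis
      by (metis append_Cons)
  qed
qed

text \<open>Because of the final \<open>0\<close>, appending block lists does not concatenate their
  words. What survives is a prefix \<open>z\<close> that is the same for all \<open>c\<close>, hence
  for both ends of an edge.\<close>

lemma word_of_blocks_append:
  "\<exists>z. \<forall>c. word_of_blocks (b @ c) = z @ word_of_blocks c"
proof (induction b)
  case Nil
  show ?case by (rule exI[of _ "[]"]) simp
next
  case (Cons a b)
  then obtain z where "\<forall>c. word_of_blocks (b @ c) = z @ word_of_blocks c" ..
  then show ?case
    by (intro exI[of _ "(if a then [0, 1, 1] else [0, 1]) @ z"]) (cases a; simp)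
qed

lemma replaces_01_by_10_blocks_iff:
  "replaces_01_by_10 (word_of_blocks a) (word_of_blocks b) \<longleftrightarrow>
     (\<exists>s t. a = s @ [False, True] @ t \<and> b = s @ [True, False] @ t)"
proof
  assume "replaces_01_by_10 (word_of_blocks a) (word_of_blocks b)"
  then show "\<exists>s t. a = s @ [False, True] @ t \<and> b = s @ [True, False] @ t"
    unfolding replaces_01_by_10_def by (blast dest: replaces_01_by_10_blocksD)
next
  assume "\<exists>s t. a = s @ [False, True] @ t \<and> b = s @ [True, False] @ t"
  then obtain s t where st: "a = s @ [False, True] @ t" "b = s @ [True, False] @ t" by blast
  obtain z where z: "\<forall>c. word_of_blocks (s @ c) = z @ word_of_blocks c"
    using word_of_blocks_append by blast
  \<comment> \<open>The exchanged blocks read \<open>01011\<close> and \<open>01101\<close>, which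
    differ only in the third and fourth letters.\<close>
  have "word_of_blocks a = (z @ [0, 1]) @ [0, 1] @ 1 # word_of_blocks t"
    "word_of_blocks b = (z @ [0, 1]) @ [1, 0] @ 1 # word_of_blocks t"
    by (simp_all add: st z)
  then show "replaces_01_by_10 (word_of_blocks a) (word_of_blocks b)"
    unfolding replaces_01_by_10_def by blast
qed

definition swap_edge :: "bool list \<times> bool list \<Rightarrow> nat list set" where
  "swap_edge = (\<lambda>(s, t). {word_of_blocks (s @ [False, True] @ t),
                          word_of_blocks (s @ [True, False] @ t)})"

text \<open>The two lists first differ right after \<open>s\<close>, which fixes the position.
  Letting \<open>a\<close> and \<open>b\<close> vary covers unordered pairs whose end points are
  matched crosswise.\<close>

lemma swap_position_unique:
  assumes "s @ [a, \<not> a] @ t = s' @ [b, \<not> b] @ t'" "s @ [\<not> a, a] @ t = s' @ [\<not> b, b] @ t'"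
  shows "s = s' \<and> a = b \<and> t = t'"
  using assms
proof (induction s arbitrary: s')
  case Nil
  then show ?case by (cases s') auto
next
  case (Cons c s)
  then show ?case by (cases s') auto
qed

lemma inj_swap_edge: "inj swap_edge"
proof (rule injI)
  fix p p' assume eq: "swap_edge p = swap_edge p'"
  obtain s t s' t' where p: "p = (s, t)" "p' = (s', t')" by (cases p, cases p') blast
  from eq show "p = p'"
    using swap_position_unique[of s False t s' False t'] swap_position_unique[of s False t s' True t']
    unfolding p swap_edge_def by (auto simp: doubleton_eq_iff)
qed

lemma Phi_edges_eq_blocks:
  "Phi_edges (2 * m + q + 1) (m + q) =
     swap_edge ` {(s, t). length (s @ t) + 2 = m \<and> count_list (s @ t) True + 1 = q}"
    (is "?E = swap_edge ` ?P")
proof (intro equalityI subsetI)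
  fix e assume "e \<in> ?E"
  \<comment> \<open>Adjacency is symmetric, so the end points can be named with the replacement
    going from \<open>u\<close> to \<open>v\<close>.\<close>
  then obtain u v where e: "e = {u, v}" and uv: "u \<in> Phi_vertices (2 * m + q + 1) (m + q)"
      "v \<in> Phi_vertices (2 * m + q + 1) (m + q)" "replaces_01_by_10 u v"
    unfolding Phi_edges_def Phi_adjacent_def by blast
  from uv(1,2) obtain a b where ab: "u = word_of_blocks a" "v = word_of_blocks b"
      "length a = m" "count_list a True = q"
    unfolding Phi_vertices_eq_blocks by blast
  with uv(3) obtain s t where "a = s @ [False, True] @ t" "b = s @ [True, False] @ t"
    unfolding replaces_01_by_10_blocks_iff ab by blast
  with e ab have "e = swap_edge (s, t)" "(s, t) \<in> ?P"
    by (auto simp: swap_edge_def)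
  then show "e \<in> swap_edge ` ?P" by blast
next
  fix e assume "e \<in> swap_edge ` ?P"
  then obtain s t where "e = swap_edge (s, t)" and st: "(s, t) \<in> ?P" by blast
  then have e: "e = {word_of_blocks (s @ [False, True] @ t), word_of_blocks (s @ [True, False] @ t)}"
    by (simp add: swap_edge_def)
  have "word_of_blocks (s @ [False, True] @ t) \<in> Phi_vertices (2 * m + q + 1) (m + q)"
    "word_of_blocks (s @ [True, False] @ t) \<in> Phi_vertices (2 * m + q + 1) (m + q)"
    using st unfolding Phi_vertices_eq_blocks by auto
  moreover have "Phi_adjacent (word_of_blocks (s @ [False, True] @ t))
      (word_of_blocks (s @ [True, False] @ t))"
    unfolding Phi_adjacent_def replaces_01_by_10_blocks_iff by blast
  ultimately show "e \<in> ?E"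
    unfolding Phi_edges_def e by blast
qed

section \<open>Counting block lists and edges\<close>

lemma finite_bool_lists_count: "finite {b. length b = m \<and> count_list b True = q}"
  by (rule finite_subset[OF _ finite_lists_length_eq[of "UNIV :: bool set" m]]) auto

text \<open>Pascal's rule, by the value of the first entry.\<close>

lemma card_bool_lists_count: "card {b. length b = m \<and> count_list b True = q} = m choose q"
proof (induction m arbitrary: q)
  case 0
  have "{b. length b = 0 \<and> count_list b True = q} = (if q = 0 then {[]} else {})" by auto
  then show ?case by (cases q) auto
next
  case (Suc m)
  let ?L = "\<lambda>m q. {b. length b = m \<and> count_list b True = q}"
  show ?case
  proof (cases q)
    case 0
    have "?L (Suc m) 0 = Cons False ` ?L m 0"
      by (auto simp: length_Suc_conv image_iff split: if_splits)
    then show ?thesis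
      using Suc 0 by (simp add: card_image)
  next
    case (Suc r)
    have "?L (Suc m) (Suc r) = Cons True ` ?L m r \<union> Cons False ` ?L m (Suc r)"
      by (auto simp: length_Suc_conv image_iff split: if_splits)
    then have "card (?L (Suc m) (Suc r)) = card (Cons True ` ?L m r) + card (Cons False ` ?L m (Suc r))"
      by (simp only:) (rule card_Un_disjoint, auto simp: finite_bool_lists_count)
    then have "card (?L (Suc m) (Suc r)) = card (?L m r) + card (?L m (Suc r))"
      by (simp add: card_image)
    then show ?thesis
      using Suc Suc.IH by (simp only: binomial_Suc_Suc)
  qed
qed

text \<open>A split is determined by the joined list and the cut position, one of \<open>0\<close>
  to \<open>l\<close>.\<close>

lemma card_splits_uniform_length:
  assumes "\<And>w. w \<in> S \<Longrightarrow> length w = l"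
  shows "card {(s, t). s @ t \<in> S} = (l + 1) * card S"
proof -
  have "bij_betw (\<lambda>(s, t). (length s, s @ t)) {(s, t). s @ t \<in> S} ({..l} \<times> S)"
    by (rule bij_betw_byWitness[where f' = "\<lambda>(i, w). (take i w, drop i w)"])
       (auto dest: assms)
  then have "card {(s, t). s @ t \<in> S} = card ({..l} \<times> S)"
    by (rule bij_betw_same_card)
  then show ?thesis by (simp add: card_cartesian_product)
qed

lemma card_Phi_edges: "card (Phi_edges (2 * m + q + 1) (m + q)) = q * (m - 1 choose q)"
proof -
  let ?P = "{(s, t). length (s @ t) + 2 = m \<and> count_list (s @ t) True + 1 = q}"
  have card_P: "card (Phi_edges (2 * m + q + 1) (m + q)) = card ?P"
    unfolding Phi_edges_eq_blocks by (rule card_image) (rule inj_on_subset[OF inj_swap_edge], simp)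
  show ?thesis
  proof (cases "m \<ge> 2 \<and> q \<ge> 1")
    case True
    then obtain l r where lr: "m = l + 2" "q = r + 1"
      by (metis add.commute le_Suc_ex)
    then have "?P = {(s, t). s @ t \<in> {b. length b = l \<and> count_list b True = r}}" by auto
    then have "card ?P = (l + 1) * card {b. length b = l \<and> count_list b True = r}"
      using card_splits_uniform_length[of "{b. length b = l \<and> count_list b True = r}" l] by simp
    also have "\<dots> = (l + 1) * (l choose r)"
      by (simp only: card_bool_lists_count)
    \<comment> \<open>Absorption:
      \<open>(l + 1) * (l choose r) = (r + 1) * (l + 1 choose (r + 1))\<close>.\<close>
    also have "\<dots> = q * (m - 1 choose q)"
      using Suc_times_binomial_eq[of l r] lr by (simp add: mult.commute)
    finally show ?thesis using card_P by simp
  next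
    case False
    then have "card ?P = 0" by auto
    \<comment> \<open>If \<open>q > 0\<close> then \<open>m < 2\<close>, so the truncated
      \<open>m - 1\<close> is \<open>0\<close>.\<close>
    moreover have "q * (m - 1 choose q) = 0"
      using False by (cases q) (auto simp: not_le)
    ultimately show ?thesis using card_P by (simp only:)
  qed
qed

theorem corollary3p3:
  fixes n k :: nat
  assumes "n \<ge> 1"
    and "\<lfloor>rat_of_nat n / 2\<rfloor> \<le> int k"
    and "int k \<le> \<lfloor>(2 * rat_of_nat n - 2) / 3\<rfloor>"
  shows "int (card (Phi_edges n k)) =
    (if rat_of_nat k \<in> {(rat_of_nat n - 1) / 2, (2 * rat_of_nat n - 2) / 3} then 0
     else (2 * int k - int n + 1) *
       int (nat (int n - int k - 2) choose nat (2 * int n - 3 * int k - 3)))"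
proof -
  \<comment> \<open>The floor admits \<open>n = 2 * k + 1\<close>, which is the case
    \<open>q = 0\<close> below.\<close>
  have "rat_of_nat n / 2 < rat_of_int (int k + 1)"
    using assms(2) by (simp add: floor_le_iff)
  then have "rat_of_nat n < rat_of_nat (2 * k + 2)" by simp
  then have lower: "n \<le> 2 * k + 1" by simp
  have "rat_of_int (int k) \<le> (2 * rat_of_nat n - 2) / 3"
    using assms(3) by (simp only: le_floor_iff)
  then have "rat_of_nat (3 * k + 2) \<le> rat_of_nat (2 * n)" by simp
  then have upper: "3 * k + 2 \<le> 2 * n" by (simp only: of_nat_le_iff)
  \<comment> \<open>The slacks of the two bounds are the numbers of blocks: \<open>q\<close> of
    \<open>110\<close> and \<open>p\<close> of \<open>10\<close>, so
    \<open>m = p + q\<close>.\<close>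
  from lower upper obtain q p where qp: "2 * k + 1 = n + q" "2 * n = 3 * k + 2 + p"
    by (auto dest!: le_Suc_ex)
  then have n: "n = 2 * (p + q) + q + 1" by presburger
  from qp have k: "k = (p + q) + q" by presburger
  have card: "card (Phi_edges n k) = q * (p + q - 1 choose q)"
    unfolding n k by (rule card_Phi_edges)
  have q0: "rat_of_nat k = (rat_of_nat n - 1) / 2 \<longleftrightarrow> q = 0"
    unfolding n k by simp
  have p0: "rat_of_nat k = (2 * rat_of_nat n - 2) / 3 \<longleftrightarrow> p = 0"
    unfolding n k by (simp add: field_simps)
  show ?thesis
  proof (cases "q = 0 \<or> p = 0")
    case True
    \<comment> \<open>With only one kind of block there is nothing to exchange: the factor
      \<open>q\<close> vanishes, or \<open>p = 0\<close> leaves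
      \<open>q - 1 choose q\<close>.\<close>
    then have "card (Phi_edges n k) = 0"
      unfolding card by (cases q) auto
    with True show ?thesis using q0 p0 by auto
  next
    case False
    have "2 * int k - int n + 1 = int q" "nat (int n - int k - 2) = p + q - 1"
      "nat (2 * int n - 3 * int k - 3) = p - 1"
      using False unfolding n k by auto
    moreover have "p + q - 1 choose q = (p + q - 1 choose (p - 1))"
      using False binomial_symmetric[of q "p + q - 1"] by (cases p) auto
    ultimately show ?thesis
      using False q0 p0 card by simp
  qed
qed

end
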